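(* Let $(M_1^4,g)$ be a 4-dimensional Lorentzian manifold and let $\alpha:I\to M_1^4$ ($I\subset\mathbb{R}$ an open interval) be a null Cartan curve parametrized by pseudo-arc $t$, with Frenet frame $\{\xi=\alpha',N,W_1,W_2\}$ and with nowhere vanishing Cartan curvatures $\sigma_1,\sigma_2$. Let $f:M_1^4\to\mathbb{R}$ be a smooth function that is eikonal along $\alpha$ and has vanishing Hessian, $H^f=0$. If $\alpha$ is a null $f$-eikonal helix in $M_1^4$, then $\alpha$ is not a null $f$-eikonal slant helix in $M_1^4$.
   Context: $(M_1^4,g)$ is a 4-dimensional Lorentzian manifold (signature $(-,+,+,+)$) with Levi-Civita connection $\nabla$. A curve $\alpha(t)$ is null if $g(\alpha',\alpha')=0$ and $\alpha'(t)\ne0$ for all $t$. Write $\alpha''=\nabla_{\alpha'}\alpha'$, $\alpha'''=\nabla_{\alpha'}\alpha''$. A null curve is parametrized by pseudo-arc if $g(\alpha'',\alpha'')=1$; it is a Cartan curve if $g(\alpha'',\alpha'')\neq0$ and $\{\alpha',\alpha'',\alpha'''\}$ is linearly independent for every $t$. The Frenet frame of a pseudo-arc parametrized Cartan curve is the frame $\{\xi=\alpha',N,W_1,W_2\}$ along $\alpha$, where $N$ is null, $g(\xi,N)=1$, each of $\xi,N$ is orthogonal to each of $W_1,W_2$, $\{W_1,W_2\}$ is orthonormal, and $$\nabla_\xi\xi=W_1,\quad \nabla_\xi N=\sigma_1W_1+\sigma_2W_2,\quad \nabla_\xi W_1=-\sigma_1\xi-N,\quad \nabla_\xi W_2=-\sigma_2\xi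 .$$ The smooth functions $\sigma_1,\sigma_2$ are the Cartan curvatures of $\alpha$. The gradient $\nabla f$ is defined by $g(\nabla f,X)=X(f)$ for all vector fields $X$. $f$ is eikonal along $\alpha$ if $\|\nabla f\|=\sqrt{|g(\nabla f,\nabla f)|}$ is constant along $\alpha$. The Hessian is $H^f(X,Y)=g(\nabla_X(\mathrm{grad} f),Y)$; $H^f=0$ means that $\nabla f$ is parallel in $M_1^4$. For $f$ eikonal along $\alpha$: $\alpha$ is a null $f$-eikonal helix if $g(\nabla f,\xi)$ is a non-zero constant along $\alpha$; $\alpha$ is a null $f$-eikonal slant helix if $g(\nabla f,N)$ is a non-zero constant along $\alpha$. *)

theory Defs
  imports "HOL-Analysis.Analysis" "HOL-Library.Function_Algebras"
begin

subsection \<open>Smooth maps between Euclidean spaces\<close>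

text \<open>
  On an open subset of a Euclidean space, a map is of class \<open>C\<^sup>k\<^sup>+\<^sup>1\<close> iff it is differentiable
  and all its directional derivatives are of class \<open>C\<^sup>k\<close>.
\<close>

primrec Ck_on :: "nat \<Rightarrow> ('a::euclidean_space \<Rightarrow> 'b::real_normed_vector) \<Rightarrow> 'a set \<Rightarrow> bool" where
  "Ck_on 0 f S \<longleftrightarrow> continuous_on S f"
| "Ck_on (Suc k) f S \<longleftrightarrow>
     (\<forall>x\<in>S. f differentiable (at x)) \<and> (\<forall>v. Ck_on k (\<lambda>x. frechet_derivative f (at x) v) S)"

definition smooth_on :: "('a::euclidean_space \<Rightarrow> 'b::real_normed_vector) \<Rightarrow> 'a set \<Rightarrow> bool" where
  "smooth_on f S \<longleftrightarrow> open S \<and> (\<forall>k. Ck_on k f S)"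


subsection \<open>Smooth manifolds\<close>

text \<open>
  The underlying space of the manifold is a whole type \<open>'m\<close>. A chart is its domain together
  with its coordinate map; only the values of the latter on the domain matter.
\<close>

type_synonym ('m, 'n) chart = "'m set \<times> ('m \<Rightarrow> real ^ 'n)"
type_synonym ('m, 'n) atlas = "('m, 'n) chart set"

abbreviation dom_chart :: "('m, 'n) chart \<Rightarrow> 'm set" where
  "dom_chart \<equiv> fst"

abbreviation coords :: "('m, 'n) chart \<Rightarrow> 'm \<Rightarrow> real ^ 'n" where
  "coords \<equiv> snd"

definition chart_inv :: "('m, 'n) chart \<Rightarrow> real ^ 'n \<Rightarrow> 'm" where
  "chart_inv c = inv_into (dom_chart c) (coords c)"

definition is_chart :: "('m::topological_space, 'n::finite) chart \<Rightarrow> bool" where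
  "is_chart c \<longleftrightarrow> open (dom_chart c) \<and> open (coords c ` dom_chart c) \<and>
     homeomorphism (dom_chart c) (coords c ` dom_chart c) (coords c) (chart_inv c)"

definition smooth_atlas :: "('m::topological_space, 'n::finite) atlas \<Rightarrow> bool" where
  "smooth_atlas A \<longleftrightarrow>
     (\<forall>c\<in>A. is_chart c) \<and> (\<Union>c\<in>A. dom_chart c) = UNIV \<and>
     (\<forall>c\<in>A. \<forall>d\<in>A. smooth_on (coords d \<circ> chart_inv c) (coords c ` (dom_chart c \<inter> dom_chart d)))"

definition smooth_fun ::
    "('m::topological_space, 'n::finite) atlas \<Rightarrow> 'm set \<Rightarrow> ('m \<Rightarrow> real) \<Rightarrow> bool" where
  "smooth_fun A U h \<longleftrightarrow> open U \<and>
     (\<forall>c\<in>A. smooth_on (h \<circ> chart_inv c) (coords c ` (dom_chart c \<inter> U)))"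


subsection \<open>Tangent vectors and vector fields\<close>

instantiation "fun" :: (type, real_vector) real_vector
begin

definition scaleR_fun :: "real \<Rightarrow> ('a \<Rightarrow> 'b) \<Rightarrow> 'a \<Rightarrow> 'b" where
  "scaleR_fun r f = (\<lambda>x. r *\<^sub>R f x)"

instance
  by standard (auto simp: scaleR_fun_def fun_eq_iff scaleR_add_right scaleR_add_left)

end

text \<open>
  A tangent vector at \<open>p\<close> is the family of its component vectors in all charts around \<open>p\<close>,
  related by the differentials of the coordinate changes. Charts not around \<open>p\<close> are given
  the value 0, so that equality of tangent vectors is equality of functions.
\<close>

type_synonym ('m, 'n) tvec = "('m, 'n) chart \<Rightarrow> real ^ 'n"

definition tangent_space ::
    "('m::topological_space, 'n::finite) atlas \<Rightarrow> 'm \<Rightarrow> ('m, 'n) tvec set" where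
  "tangent_space A p = {v.
     (\<forall>c\<in>A. \<forall>d\<in>A. p \<in> dom_chart c \<longrightarrow> p \<in> dom_chart d \<longrightarrow>
        v d = frechet_derivative (coords d \<circ> chart_inv c) (at (coords c p)) (v c)) \<and>
     (\<forall>c. \<not> (c \<in> A \<and> p \<in> dom_chart c) \<longrightarrow> v c = 0)}"

definition chart_at :: "('m::topological_space, 'n::finite) atlas \<Rightarrow> 'm \<Rightarrow> ('m, 'n) chart" where
  "chart_at A p = (SOME c. c \<in> A \<and> p \<in> dom_chart c)"

text \<open>
  The derivative \<open>v(h)\<close> of a function \<open>h\<close>, smooth near \<open>p\<close>, along a tangent vector \<open>v\<close> at \<open>p\<close>.
  By the chain rule it does not depend on the chart used.
\<close>

definition tderiv ::
    "('m::topological_space, 'n::finite) atlas \<Rightarrow> 'm \<Rightarrow> ('m, 'n) tvec \<Rightarrow> ('m \<Rightarrow> real) \<Rightarrow> real" where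
  "tderiv A p v h =
     (let c = chart_at A p in frechet_derivative (h \<circ> chart_inv c) (at (coords c p)) (v c))"

definition smooth_vfield ::
    "('m::topological_space, 'n::finite) atlas \<Rightarrow> 'm set \<Rightarrow> ('m \<Rightarrow> ('m, 'n) tvec) \<Rightarrow> bool" where
  "smooth_vfield A U X \<longleftrightarrow> open U \<and> (\<forall>p\<in>U. X p \<in> tangent_space A p) \<and>
     (\<forall>c\<in>A. smooth_on (\<lambda>x. X (chart_inv c x) c) (coords c ` (dom_chart c \<inter> U)))"

text \<open>The coordinate vector field \<open>\<partial>\<^sub>i\<close> of a chart \<open>c\<close>, of interest on the domain of \<open>c\<close> only.\<close>

definition coord_vfield ::
    "('m::topological_space, 'n::finite) atlas \<Rightarrow> ('m, 'n) chart \<Rightarrow> 'n \<Rightarrow> 'm \<Rightarrow> ('m, 'n) tvec" where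
  "coord_vfield A c i p = (\<lambda>d. if d \<in> A \<and> p \<in> dom_chart d
     then frechet_derivative (coords d \<circ> chart_inv c) (at (coords c p)) (axis i 1) else 0)"


subsection \<open>Lorentzian metrics\<close>

type_synonym ('m, 'n) metric = "'m \<Rightarrow> ('m, 'n) tvec \<Rightarrow> ('m, 'n) tvec \<Rightarrow> real"

text \<open>
  The signature condition asks for \<open>CARD('n)\<close> pairwise orthogonal vectors, exactly one of square
  \<open>-1\<close> and the others of square \<open>1\<close>. Such vectors automatically form a basis of the tangent space.
\<close>

definition lorentzian_metric ::
    "('m::topological_space, 'n::finite) atlas \<Rightarrow> ('m, 'n) metric \<Rightarrow> bool" where
  "lorentzian_metric A g \<longleftrightarrow>
     (\<forall>p. \<forall>u\<in>tangent_space A p. \<forall>v\<in>tangent_space A p. g p u v = g p v u) \<and>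
     (\<forall>p. \<forall>u\<in>tangent_space A p. \<forall>v\<in>tangent_space A p. \<forall>w\<in>tangent_space A p.
        g p (u + v) w = g p u w + g p v w) \<and>
     (\<forall>p r. \<forall>u\<in>tangent_space A p. \<forall>v\<in>tangent_space A p. g p (r *\<^sub>R u) v = r * g p u v) \<and>
     (\<forall>c\<in>A. \<forall>i j. smooth_fun A (dom_chart c)
        (\<lambda>p. g p (coord_vfield A c i p) (coord_vfield A c j p))) \<and>
     (\<forall>p. \<exists>(e :: 'n \<Rightarrow> ('m, 'n) tvec) i\<^sub>0. (\<forall>i. e i \<in> tangent_space A p) \<and>
        (\<forall>i j. g p (e i) (e j) = (if i \<noteq> j then 0 else if i = i\<^sub>0 then -1 else 1)))"

definition lorentzian_manifold ::
    "('m::{t2_space,second_countable_topology}, 'n::finite) atlas \<Rightarrow> ('m, 'n) metric \<Rightarrow> bool" where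
  "lorentzian_manifold A g \<longleftrightarrow> smooth_atlas A \<and> lorentzian_metric A g"


subsection \<open>The Levi-Civita connection\<close>

text \<open>
  \<open>nabla p v Y\<close> is the covariant derivative at \<open>p\<close>, in the direction of the tangent vector \<open>v\<close>,
  of a vector field \<open>Y\<close> that is smooth on some open neighbourhood of \<open>p\<close>. Since connections are
  local operators, this is the same as a connection acting on globally defined fields.
\<close>

type_synonym ('m, 'n) connection =
  "'m \<Rightarrow> ('m, 'n) tvec \<Rightarrow> ('m \<Rightarrow> ('m, 'n) tvec) \<Rightarrow> ('m, 'n) tvec"

definition affine_connection ::
    "('m::topological_space, 'n::finite) atlas \<Rightarrow> ('m, 'n) connection \<Rightarrow> bool" where
  "affine_connection A nabla \<longleftrightarrow>
     (\<forall>U X Y. smooth_vfield A U X \<longrightarrow> smooth_vfield A U Y \<longrightarrow>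
        smooth_vfield A U (\<lambda>p. nabla p (X p) Y)) \<and>
     (\<forall>U Y. smooth_vfield A U Y \<longrightarrow> (\<forall>p\<in>U. \<forall>v\<in>tangent_space A p.
        nabla p v Y \<in> tangent_space A p)) \<and>
     (\<forall>U Y. smooth_vfield A U Y \<longrightarrow> (\<forall>p\<in>U. \<forall>u\<in>tangent_space A p. \<forall>v\<in>tangent_space A p. \<forall>r s.
        nabla p (r *\<^sub>R u + s *\<^sub>R v) Y = r *\<^sub>R nabla p u Y + s *\<^sub>R nabla p v Y)) \<and>
     (\<forall>U Y Z. smooth_vfield A U Y \<longrightarrow> smooth_vfield A U Z \<longrightarrow>
        (\<forall>p\<in>U. \<forall>v\<in>tangent_space A p.
          nabla p v (\<lambda>q. Y q + Z q) = nabla p v Y + nabla p v Z)) \<and>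
     (\<forall>U h Y. smooth_fun A U h \<longrightarrow> smooth_vfield A U Y \<longrightarrow>
        (\<forall>p\<in>U. \<forall>v\<in>tangent_space A p.
          nabla p v (\<lambda>q. h q *\<^sub>R Y q) = tderiv A p v h *\<^sub>R Y p + h p *\<^sub>R nabla p v Y)) \<and>
     (\<forall>U Y Z. smooth_vfield A U Y \<longrightarrow> (\<forall>q\<in>U. Y q = Z q) \<longrightarrow>
        (\<forall>p\<in>U. \<forall>v\<in>tangent_space A p. nabla p v Y = nabla p v Z))"

text \<open>\<open>\<nabla>\<^sub>X Y - \<nabla>\<^sub>Y X = [X,Y]\<close>, where \<open>[X,Y](h) = X(Y(h)) - Y(X(h))\<close>\<close>

definition torsion_free ::
    "('m::topological_space, 'n::finite) atlas \<Rightarrow> ('m, 'n) connection \<Rightarrow> bool" where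
  "torsion_free A nabla \<longleftrightarrow>
     (\<forall>U X Y h. smooth_vfield A U X \<longrightarrow> smooth_vfield A U Y \<longrightarrow> smooth_fun A U h \<longrightarrow>
        (\<forall>p\<in>U. tderiv A p (nabla p (X p) Y - nabla p (Y p) X) h =
           tderiv A p (X p) (\<lambda>q. tderiv A q (Y q) h) - tderiv A p (Y p) (\<lambda>q. tderiv A q (X q) h)))"

definition metric_compatible ::
    "('m::topological_space, 'n::finite) atlas \<Rightarrow> ('m, 'n) metric \<Rightarrow> ('m, 'n) connection \<Rightarrow> bool" where
  "metric_compatible A g nabla \<longleftrightarrow>
     (\<forall>U Y Z. smooth_vfield A U Y \<longrightarrow> smooth_vfield A U Z \<longrightarrow>
        (\<forall>p\<in>U. \<forall>v\<in>tangent_space A p.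
           tderiv A p v (\<lambda>q. g q (Y q) (Z q)) = g p (nabla p v Y) (Z p) + g p (Y p) (nabla p v Z)))"

definition levi_civita ::
    "('m::topological_space, 'n::finite) atlas \<Rightarrow> ('m, 'n) metric \<Rightarrow> ('m, 'n) connection \<Rightarrow> bool" where
  "levi_civita A g nabla \<longleftrightarrow>
     affine_connection A nabla \<and> torsion_free A nabla \<and> metric_compatible A g nabla"


subsection \<open>Gradient and Hessian\<close>

text \<open>Since the metric is smooth and nondegenerate, a smooth function has exactly one gradient.\<close>

definition is_gradient ::
    "('m::topological_space, 'n::finite) atlas \<Rightarrow> ('m, 'n) metric \<Rightarrow> ('m \<Rightarrow> real) \<Rightarrow>
     ('m \<Rightarrow> ('m, 'n) tvec) \<Rightarrow> bool" where
  "is_gradient A g f G \<longleftrightarrow> smooth_vfield A UNIV G \<and>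
     (\<forall>p. \<forall>v\<in>tangent_space A p. g p (G p) v = tderiv A p v f)"

text \<open>The Hessian of the function with gradient \<open>G\<close>.\<close>

definition hessian ::
    "('m, 'n::finite) metric \<Rightarrow> ('m, 'n) connection \<Rightarrow> ('m \<Rightarrow> ('m, 'n) tvec) \<Rightarrow>
     'm \<Rightarrow> ('m, 'n) tvec \<Rightarrow> ('m, 'n) tvec \<Rightarrow> real" where
  "hessian g nabla G p u v = g p (nabla p u G) v"


subsection \<open>Curves and covariant differentiation along a curve\<close>

definition smooth_curve ::
    "('m::topological_space, 'n::finite) atlas \<Rightarrow> real set \<Rightarrow> (real \<Rightarrow> 'm) \<Rightarrow> bool" where
  "smooth_curve A I \<alpha> \<longleftrightarrow> continuous_on I \<alpha> \<and>
     (\<forall>c\<in>A. smooth_on (coords c \<circ> \<alpha>) {t\<in>I. \<alpha> t \<in> dom_chart c})"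

definition velocity ::
    "('m::topological_space, 'n::finite) atlas \<Rightarrow> (real \<Rightarrow> 'm) \<Rightarrow> real \<Rightarrow> ('m, 'n) tvec" where
  "velocity A \<alpha> t = (\<lambda>c. if c \<in> A \<and> \<alpha> t \<in> dom_chart c
     then vector_derivative (coords c \<circ> \<alpha>) (at t) else 0)"

definition smooth_vfield_along ::
    "('m::topological_space, 'n::finite) atlas \<Rightarrow> real set \<Rightarrow> (real \<Rightarrow> 'm) \<Rightarrow>
     (real \<Rightarrow> ('m, 'n) tvec) \<Rightarrow> bool" where
  "smooth_vfield_along A I \<alpha> V \<longleftrightarrow> (\<forall>t\<in>I. V t \<in> tangent_space A (\<alpha> t)) \<and>
     (\<forall>c\<in>A. smooth_on (\<lambda>t. V t c) {t\<in>I. \<alpha> t \<in> dom_chart c})"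

text \<open>
  If \<open>V = \<Sum>\<^sub>i V\<^sup>i \<partial>\<^sub>i\<close> in a chart around \<open>\<alpha> t\<close>, the covariant derivative of \<open>V\<close> along \<open>\<alpha>\<close> at \<open>t\<close> is
  \<open>\<Sum>\<^sub>i (V\<^sup>i)' \<partial>\<^sub>i + V\<^sup>i \<nabla>\<^bsub>\<alpha>'\<^esub> \<partial>\<^sub>i\<close>. By the Leibniz rule for \<open>\<nabla>\<close> it does not depend on the chart.
\<close>

definition cov_deriv_along ::
    "('m::topological_space, 'n::finite) atlas \<Rightarrow> ('m, 'n) connection \<Rightarrow> (real \<Rightarrow> 'm) \<Rightarrow>
     (real \<Rightarrow> ('m, 'n) tvec) \<Rightarrow> real \<Rightarrow> ('m, 'n) tvec" where
  "cov_deriv_along A nabla \<alpha> V t =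
     (let c = chart_at A (\<alpha> t) in
      \<Sum>i\<in>UNIV. vector_derivative (\<lambda>s. V s c $ i) (at t) *\<^sub>R coord_vfield A c i (\<alpha> t) +
               (V t c $ i) *\<^sub>R nabla (\<alpha> t) (velocity A \<alpha> t) (coord_vfield A c i))"

definition accel ::
    "('m::topological_space, 'n::finite) atlas \<Rightarrow> ('m, 'n) connection \<Rightarrow> (real \<Rightarrow> 'm) \<Rightarrow>
     real \<Rightarrow> ('m, 'n) tvec" where
  "accel A nabla \<alpha> = cov_deriv_along A nabla \<alpha> (velocity A \<alpha>)"

definition jerk ::
    "('m::topological_space, 'n::finite) atlas \<Rightarrow> ('m, 'n) connection \<Rightarrow> (real \<Rightarrow> 'm) \<Rightarrow>
     real \<Rightarrow> ('m, 'n) tvec" where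
  "jerk A nabla \<alpha> = cov_deriv_along A nabla \<alpha> (accel A nabla \<alpha>)"


subsection \<open>Null Cartan curves and their Frenet frames\<close>

definition null_curve ::
    "('m::topological_space, 'n::finite) atlas \<Rightarrow> ('m, 'n) metric \<Rightarrow> real set \<Rightarrow> (real \<Rightarrow> 'm) \<Rightarrow> bool" where
  "null_curve A g I \<alpha> \<longleftrightarrow> smooth_curve A I \<alpha> \<and>
     (\<forall>t\<in>I. g (\<alpha> t) (velocity A \<alpha> t) (velocity A \<alpha> t) = 0 \<and> velocity A \<alpha> t \<noteq> 0)"

definition pseudo_arc ::
    "('m::topological_space, 'n::finite) atlas \<Rightarrow> ('m, 'n) metric \<Rightarrow> ('m, 'n) connection \<Rightarrow>
     real set \<Rightarrow> (real \<Rightarrow> 'm) \<Rightarrow> bool" where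
  "pseudo_arc A g nabla I \<alpha> \<longleftrightarrow>
     (\<forall>t\<in>I. g (\<alpha> t) (accel A nabla \<alpha> t) (accel A nabla \<alpha> t) = 1)"

definition null_cartan_curve ::
    "('m::topological_space, 'n::finite) atlas \<Rightarrow> ('m, 'n) metric \<Rightarrow> ('m, 'n) connection \<Rightarrow>
     real set \<Rightarrow> (real \<Rightarrow> 'm) \<Rightarrow> bool" where
  "null_cartan_curve A g nabla I \<alpha> \<longleftrightarrow> null_curve A g I \<alpha> \<and>
     (\<forall>t\<in>I. g (\<alpha> t) (accel A nabla \<alpha> t) (accel A nabla \<alpha> t) \<noteq> 0 \<and>
        (\<forall>a b c. a *\<^sub>R velocity A \<alpha> t + b *\<^sub>R accel A nabla \<alpha> t + c *\<^sub>R jerk A nabla \<alpha> t = 0 \<longrightarrow>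
           a = 0 \<and> b = 0 \<and> c = 0))"

definition frenet_frame ::
    "('m::topological_space, 4) atlas \<Rightarrow> ('m, 4) metric \<Rightarrow> ('m, 4) connection \<Rightarrow>
     real set \<Rightarrow> (real \<Rightarrow> 'm) \<Rightarrow> (real \<Rightarrow> ('m, 4) tvec) \<Rightarrow> (real \<Rightarrow> ('m, 4) tvec) \<Rightarrow>
     (real \<Rightarrow> ('m, 4) tvec) \<Rightarrow> (real \<Rightarrow> ('m, 4) tvec) \<Rightarrow> (real \<Rightarrow> real) \<Rightarrow> (real \<Rightarrow> real) \<Rightarrow> bool" where
  "frenet_frame A g nabla I \<alpha> \<xi> N W\<^sub>1 W\<^sub>2 \<sigma>\<^sub>1 \<sigma>\<^sub>2 \<longleftrightarrow>
     smooth_vfield_along A I \<alpha> \<xi> \<and> smooth_vfield_along A I \<alpha> N \<and>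
     smooth_vfield_along A I \<alpha> W\<^sub>1 \<and> smooth_vfield_along A I \<alpha> W\<^sub>2 \<and>
     smooth_on \<sigma>\<^sub>1 I \<and> smooth_on \<sigma>\<^sub>2 I \<and>
     (\<forall>t\<in>I.
        \<xi> t = velocity A \<alpha> t \<and>
        g (\<alpha> t) (N t) (N t) = 0 \<and> N t \<noteq> 0 \<and> g (\<alpha> t) (\<xi> t) (N t) = 1 \<and>
        g (\<alpha> t) (\<xi> t) (W\<^sub>1 t) = 0 \<and> g (\<alpha> t) (\<xi> t) (W\<^sub>2 t) = 0 \<and>
        g (\<alpha> t) (N t) (W\<^sub>1 t) = 0 \<and> g (\<alpha> t) (N t) (W\<^sub>2 t) = 0 \<and>
        g (\<alpha> t) (W\<^sub>1 t) (W\<^sub>1 t) = 1 \<and> g (\<alpha> t) (W\<^sub>2 t) (W\<^sub>2 t) = 1 \<and> g (\<alpha> t) (W\<^sub>1 t) (W\<^sub>2 t) = 0 \<and>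
        cov_deriv_along A nabla \<alpha> \<xi> t = W\<^sub>1 t \<and>
        cov_deriv_along A nabla \<alpha> N t = \<sigma>\<^sub>1 t *\<^sub>R W\<^sub>1 t + \<sigma>\<^sub>2 t *\<^sub>R W\<^sub>2 t \<and>
        cov_deriv_along A nabla \<alpha> W\<^sub>1 t = - (\<sigma>\<^sub>1 t *\<^sub>R \<xi> t) - N t \<and>
        cov_deriv_along A nabla \<alpha> W\<^sub>2 t = - (\<sigma>\<^sub>2 t *\<^sub>R \<xi> t))"


subsection \<open>Eikonal functions and helices\<close>

text \<open>Below, \<open>G\<close> is the gradient of the function in question.\<close>

definition eikonal_along ::
    "('m, 'n::finite) metric \<Rightarrow> ('m \<Rightarrow> ('m, 'n) tvec) \<Rightarrow> real set \<Rightarrow> (real \<Rightarrow> 'm) \<Rightarrow> bool" where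
  "eikonal_along g G I \<alpha> \<longleftrightarrow> (\<exists>k. \<forall>t\<in>I. sqrt \<bar>g (\<alpha> t) (G (\<alpha> t)) (G (\<alpha> t))\<bar> = k)"

definition null_eikonal_helix ::
    "('m, 'n::finite) metric \<Rightarrow> ('m \<Rightarrow> ('m, 'n) tvec) \<Rightarrow> real set \<Rightarrow> (real \<Rightarrow> 'm) \<Rightarrow>
     (real \<Rightarrow> ('m, 'n) tvec) \<Rightarrow> bool" where
  "null_eikonal_helix g G I \<alpha> \<xi> \<longleftrightarrow> eikonal_along g G I \<alpha> \<and>
     (\<exists>k. k \<noteq> 0 \<and> (\<forall>t\<in>I. g (\<alpha> t) (G (\<alpha> t)) (\<xi> t) = k))"

definition null_eikonal_slant_helix ::
    "('m, 'n::finite) metric \<Rightarrow> ('m \<Rightarrow> ('m, 'n) tvec) \<Rightarrow> real set \<Rightarrow> (real \<Rightarrow> 'm) \<Rightarrow>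
     (real \<Rightarrow> ('m, 'n) tvec) \<Rightarrow> bool" where
  "null_eikonal_slant_helix g G I \<alpha> N \<longleftrightarrow> eikonal_along g G I \<alpha> \<and>
     (\<exists>k. k \<noteq> 0 \<and> (\<forall>t\<in>I. g (\<alpha> t) (G (\<alpha> t)) (N t) = k))"

end

theory Submission
  imports Defs
begin

text \<open>
  Write \<open>G\<close> for the gradient of \<open>f\<close>. The vanishing of the Hessian says that \<open>G\<close> is parallel, so the
  product rule \<open>(d/dt) g(G, V) = g(\<nabla>\<^bsub>\<alpha>'\<^esub> G, V) + g(G, DV/dt)\<close> loses its first term: whenever \<open>g(G, V)\<close> is
  constant along \<open>\<alpha>\<close>, \<open>G\<close> is orthogonal to \<open>DV/dt\<close>. Applying this to the Frenet equations one after
  the other refutes the existence of a curve that is both a helix and a slant helix. Constancy of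
  \<open>g(G, \<xi>)\<close> gives \<open>g(G, W\<^sub>1) = 0\<close>. Constancy of \<open>g(G, N)\<close> gives
  \<open>\<sigma>\<^sub>1 g(G, W\<^sub>1) + \<sigma>\<^sub>2 g(G, W\<^sub>2) = 0\<close>, hence \<open>g(G, W\<^sub>2) = 0\<close> because \<open>\<sigma>\<^sub>2\<close> does not vanish. Constancy of
  this last function gives \<open>\<sigma>\<^sub>2 g(G, \<xi>) = 0\<close>, which contradicts \<open>g(G, \<xi>) \<noteq> 0\<close>.

  The substance of the formal proof is the product rule \<open>metric_derivative_along_curve\<close>. The
  connection and its compatibility with the metric speak of vector fields on open sets of the
  manifold, whereas \<open>V\<close> lives on the curve only. Expanding \<open>V\<close> in the coordinate fields of a chart
  (\<open>tangent_vector_expansion\<close>) bridges the gap: the coefficients are functions of the parameter, and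
  the coordinate fields are fields to which metric compatibility applies. For that they must be
  smooth in every other chart as well (\<open>smooth_coord_vfield\<close>), and this needs the closure of the
  classes \<open>C\<^sup>k\<close> under composition (\<open>Ck_on_compose\<close>).
\<close>


section \<open>Calculus of the classes \<open>C\<^sup>k\<close>\<close>

lemma Ck_on_cong:
  assumes "open S" "\<And>x. x \<in> S \<Longrightarrow> f x = h x" "Ck_on k f S"
  shows "Ck_on k h S"
  using assms(2,3)
proof (induction k arbitrary: f h)
  case 0
  then show ?case using continuous_on_cong[of S S f h] by simp
next
  case (Suc k)
  have diff: "f differentiable (at x)" if "x \<in> S" for x
    using Suc.prems(2) that by simp
  have "h differentiable (at x)" if "x \<in> S" for x
    using diff[OF that] has_derivative_transform_within_open[OF _ \<open>open S\<close> that, of f _ UNIV h]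
      Suc.prems(1) unfolding differentiable_def by blast
  moreover have "Ck_on k (\<lambda>x. frechet_derivative h (at x) v) S" for v
  proof (rule Suc.IH)
    show "Ck_on k (\<lambda>x. frechet_derivative f (at x) v) S"
      using Suc.prems(2) by simp
    show "frechet_derivative f (at x) v = frechet_derivative h (at x) v" if "x \<in> S" for x
      using frechet_derivative_transform_within_open[OF diff[OF that] \<open>open S\<close> that, of h]
        Suc.prems(1) by simp
  qed
  ultimately show ?case by simp
qed

lemma Ck_on_subset: "Ck_on k f S \<Longrightarrow> T \<subseteq> S \<Longrightarrow> Ck_on k f T"
  by (induction k arbitrary: f) (auto intro: continuous_on_subset)

lemma Ck_on_SucD: "Ck_on (Suc k) f S \<Longrightarrow> Ck_on k f S"
proof (induction k arbitrary: f)
  case 0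
  then show ?case
    by (auto intro!: continuous_at_imp_continuous_on differentiable_imp_continuous_within)
next
  case (Suc k)
  then show ?case by simp
qed

lemma Ck_on_zero: "Ck_on k (\<lambda>x. 0) S"
  by (induction k) auto

lemma Ck_on_add:
  assumes "open S" "Ck_on k f S" "Ck_on k h S"
  shows "Ck_on k (\<lambda>x. f x + h x) S"
  using assms(2,3)
proof (induction k arbitrary: f h)
  case 0
  then show ?case by (simp add: continuous_on_add)
next
  case (Suc k)
  have d: "f differentiable (at x)" "h differentiable (at x)" if "x \<in> S" for x
    using Suc.prems that by auto
  have "Ck_on k (\<lambda>x. frechet_derivative (\<lambda>x. f x + h x) (at x) v) S" for v
  proof (rule Ck_on_cong[OF \<open>open S\<close>])
    show "Ck_on k (\<lambda>x. frechet_derivative f (at x) v + frechet_derivative h (at x) v) S"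
      using Suc.prems by (intro Suc.IH) auto
    show "frechet_derivative f (at x) v + frechet_derivative h (at x) v =
        frechet_derivative (\<lambda>x. f x + h x) (at x) v" if "x \<in> S" for x
      using frechet_derivative_at[OF has_derivative_add
          [OF d(1)[OF that, unfolded frechet_derivative_works] d(2)[OF that, unfolded frechet_derivative_works]]]
      by metis
  qed
  then show ?case using d by (auto intro: differentiable_add)
qed

lemma Ck_on_sum:
  assumes "open S" "finite B" "\<And>b. b \<in> B \<Longrightarrow> Ck_on k (f b) S"
  shows "Ck_on k (\<lambda>x. \<Sum>b\<in>B. f b x) S"
  using assms(2,3) by induction (auto intro: Ck_on_zero Ck_on_add[OF assms(1)])

lemma Ck_on_bounded_linear:
  assumes "bounded_linear L" "open S" "Ck_on k f S"
  shows "Ck_on k (\<lambda>x. L (f x)) S"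
  using assms(3)
proof (induction k arbitrary: f)
  case 0
  then show ?case
    using bounded_linear.continuous_on[OF assms(1)] by simp
next
  case (Suc k)
  have d: "((\<lambda>x. L (f x)) has_derivative (\<lambda>v. L (frechet_derivative f (at x) v))) (at x)"
    if "x \<in> S" for x
    using Suc.prems that
    by (intro bounded_linear.has_derivative[OF assms(1)]) (simp flip: frechet_derivative_works)
  have "Ck_on k (\<lambda>x. frechet_derivative (\<lambda>x. L (f x)) (at x) v) S" for v
  proof (rule Ck_on_cong[OF \<open>open S\<close>])
    show "Ck_on k (\<lambda>x. L (frechet_derivative f (at x) v)) S"
      using Suc.prems by (intro Suc.IH) auto
    show "L (frechet_derivative f (at x) v) = frechet_derivative (\<lambda>x. L (f x)) (at x) v"
      if "x \<in> S" for x
      using frechet_derivative_at[OF d[OF that]] by metis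
  qed
  then show ?case using d by (auto simp: differentiable_def)
qed

lemma Ck_on_scaleR:
  assumes "open S" "Ck_on k f S" "Ck_on k h S"
  shows "Ck_on k (\<lambda>x. f x *\<^sub>R h x) S"
  using assms(2,3)
proof (induction k arbitrary: f h)
  case 0
  then show ?case by (simp add: continuous_on_scaleR)
next
  case (Suc k)
  have d: "((\<lambda>x. f x *\<^sub>R h x) has_derivative
      (\<lambda>v. f x *\<^sub>R frechet_derivative h (at x) v + frechet_derivative f (at x) v *\<^sub>R h x)) (at x)"
    if "x \<in> S" for x
    using Suc.prems that
    by (intro has_derivative_scaleR) (simp_all flip: frechet_derivative_works)
  have "Ck_on k (\<lambda>x. frechet_derivative (\<lambda>x. f x *\<^sub>R h x) (at x) v) S" for v
  proof (rule Ck_on_cong[OF \<open>open S\<close>])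
    show "Ck_on k (\<lambda>x. f x *\<^sub>R frechet_derivative h (at x) v +
        frechet_derivative f (at x) v *\<^sub>R h x) S"
      using Suc.prems Ck_on_SucD[OF Suc.prems(1)] Ck_on_SucD[OF Suc.prems(2)]
      by (intro Ck_on_add[OF \<open>open S\<close>] Suc.IH) auto
    show "f x *\<^sub>R frechet_derivative h (at x) v + frechet_derivative f (at x) v *\<^sub>R h x =
        frechet_derivative (\<lambda>x. f x *\<^sub>R h x) (at x) v" if "x \<in> S" for x
      using frechet_derivative_at[OF d[OF that]] by metis
  qed
  then show ?case using d by (auto simp: differentiable_def)
qed

text \<open>
  The chain rule gives the derivative of \<open>f \<circ> h\<close> in the direction \<open>v\<close> as \<open>f'(h x)(h'(x) v)\<close>.
  Here the direction varies with \<open>x\<close>, whereas the hypothesis on \<open>f\<close> concerns fixed directions;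
  expanding \<open>h'(x) v\<close> in an orthonormal basis reduces the former to the latter.
\<close>

lemma Ck_on_compose:
  fixes f :: "'b::euclidean_space \<Rightarrow> 'c::real_normed_vector"
    and h :: "'a::euclidean_space \<Rightarrow> 'b"
  assumes "open S" "Ck_on k f T" "Ck_on k h S" "h ` S \<subseteq> T"
  shows "Ck_on k (\<lambda>x. f (h x)) S"
  using assms(2-4)
proof (induction k arbitrary: f)
  case 0
  then show ?case by (auto intro: continuous_on_compose2)
next
  case (Suc k)
  have df: "f differentiable (at (h x))" and dh: "h differentiable (at x)" if "x \<in> S" for x
    using Suc.prems that by auto
  have "Ck_on k (\<lambda>x. frechet_derivative (\<lambda>x. f (h x)) (at x) v) S" for v
  proof (rule Ck_on_cong[OF \<open>open S\<close>])
    show "Ck_on k (\<lambda>x. \<Sum>b\<in>Basis. (frechet_derivative h (at x) v \<bullet> b) *\<^sub>R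
        frechet_derivative f (at (h x)) b) S"
    proof (intro Ck_on_sum[OF \<open>open S\<close>] Ck_on_scaleR[OF \<open>open S\<close>] finite_Basis)
      show "Ck_on k (\<lambda>x. frechet_derivative h (at x) v \<bullet> b) S" for b
        using Suc.prems(2) by (intro Ck_on_bounded_linear[OF bounded_linear_inner_left \<open>open S\<close>]) simp
      show "Ck_on k (\<lambda>x. frechet_derivative f (at (h x)) b) S" for b
        using Suc.prems Ck_on_SucD[OF Suc.prems(2)] by (intro Suc.IH) auto
    qed
    show "(\<Sum>b\<in>Basis. (frechet_derivative h (at x) v \<bullet> b) *\<^sub>R frechet_derivative f (at (h x)) b) =
        frechet_derivative (\<lambda>x. f (h x)) (at x) v" if "x \<in> S" for x
    proof -
      have lin: "linear (frechet_derivative f (at (h x)))"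
        using df[OF that] by (rule linear_frechet_derivative)
      have "frechet_derivative (\<lambda>x. f (h x)) (at x) v =
          frechet_derivative f (at (h x)) (frechet_derivative h (at x) v)"
        using frechet_derivative_compose[OF dh[OF that] df[OF that]] by (simp add: o_def)
      also have "\<dots> = frechet_derivative f (at (h x))
          (\<Sum>b\<in>Basis. (frechet_derivative h (at x) v \<bullet> b) *\<^sub>R b)"
        by (simp add: euclidean_representation)
      finally show ?thesis
        by (simp add: linear_sum[OF lin] linear_scale[OF lin])
    qed
  qed
  moreover have "(\<lambda>x. f (h x)) differentiable (at x)" if "x \<in> S" for x
    using differentiable_chain_at[OF dh[OF that] df[OF that]] by (simp add: o_def)
  ultimately show ?case by simp
qed

lemma smooth_on_imp_differentiable:
  assumes "smooth_on f S" "x \<in> S"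
  shows "f differentiable (at x)"
proof -
  have "Ck_on (Suc 0) f S" using assms(1) unfolding smooth_on_def by blast
  then show ?thesis using assms(2) by simp
qed


section \<open>Tangent vectors and coordinate fields\<close>

lemma chart_inv_coords:
  assumes "smooth_atlas A" "c \<in> A" "p \<in> dom_chart c"
  shows "chart_inv c (coords c p) = p"
  using assms unfolding smooth_atlas_def is_chart_def
  by (meson homeomorphism_apply1)

lemma chart_at_mem:
  assumes "smooth_atlas A"
  shows "chart_at A p \<in> A" "p \<in> dom_chart (chart_at A p)"
proof -
  have "\<exists>c. c \<in> A \<and> p \<in> dom_chart c"
    using assms unfolding smooth_atlas_def by blast
  from someI_ex[OF this] show "chart_at A p \<in> A" "p \<in> dom_chart (chart_at A p)"
    unfolding chart_at_def by auto
qed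

lemma smooth_transition:
  assumes "smooth_atlas A" "c \<in> A" "d \<in> A"
  shows "smooth_on (coords d \<circ> chart_inv c) (coords c ` (dom_chart c \<inter> dom_chart d))"
  using assms unfolding smooth_atlas_def by blast

lemma transition_differentiable:
  assumes "smooth_atlas A" "c \<in> A" "d \<in> A" "p \<in> dom_chart c" "p \<in> dom_chart d"
  shows "(coords d \<circ> chart_inv c) differentiable (at (coords c p))"
  using smooth_on_imp_differentiable[OF smooth_transition[OF assms(1-3)]] assms(4,5) by blast

lemma linear_transition_derivative:
  assumes "smooth_atlas A" "c \<in> A" "d \<in> A" "p \<in> dom_chart c" "p \<in> dom_chart d"
  shows "linear (frechet_derivative (coords d \<circ> chart_inv c) (at (coords c p)))"
  using transition_differentiable[OF assms] by (rule linear_frechet_derivative)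

text \<open>
  The chain rule for coordinate changes. It is what makes the components of a coordinate field, or
  of the velocity of a curve, in the various charts fit together to a tangent vector.
\<close>

lemma transition_derivative_cocycle:
  assumes A: "smooth_atlas A" and c: "c \<in> A" "p \<in> dom_chart c"
    and d: "d \<in> A" "p \<in> dom_chart d" and e: "e \<in> A" "p \<in> dom_chart e"
  shows "frechet_derivative (coords e \<circ> chart_inv c) (at (coords c p)) v =
    frechet_derivative (coords e \<circ> chart_inv d) (at (coords d p))
      (frechet_derivative (coords d \<circ> chart_inv c) (at (coords c p)) v)"
proof -
  let ?T = "coords d \<circ> chart_inv c" and ?R = "coords e \<circ> chart_inv d"
  let ?S = "coords c ` (dom_chart c \<inter> dom_chart d)"
  have Tp: "?T (coords c p) = coords d p"
    using chart_inv_coords[OF A c] by simp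
  have dT: "?T differentiable (at (coords c p))"
    by (rule transition_differentiable[OF A c(1) d(1) c(2) d(2)])
  have dR: "?R differentiable (at (?T (coords c p)))"
    unfolding Tp by (rule transition_differentiable[OF A d(1) e(1) d(2) e(2)])
  have "(?R \<circ> ?T) differentiable (at (coords c p))"
    using dT dR by (rule differentiable_chain_at)
  moreover have "open ?S"
    using smooth_transition[OF A c(1) d(1)] by (simp add: smooth_on_def)
  moreover have "coords c p \<in> ?S" using c d by blast
  moreover have "(?R \<circ> ?T) x = (coords e \<circ> chart_inv c) x" if "x \<in> ?S" for x
    using that chart_inv_coords[OF A c(1)] chart_inv_coords[OF A d(1)] by auto
  ultimately have "frechet_derivative (?R \<circ> ?T) (at (coords c p)) =
      frechet_derivative (coords e \<circ> chart_inv c) (at (coords c p))"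
    by (rule frechet_derivative_transform_within_open)
  with frechet_derivative_compose[OF dT dR] Tp show ?thesis by (metis comp_apply)
qed

lemma tangent_space_transform:
  assumes "v \<in> tangent_space A p" "c \<in> A" "d \<in> A" "p \<in> dom_chart c" "p \<in> dom_chart d"
  shows "v d = frechet_derivative (coords d \<circ> chart_inv c) (at (coords c p)) (v c)"
  using assms unfolding tangent_space_def by blast

lemma tangent_space_outside:
  assumes "v \<in> tangent_space A p" "\<not> (c \<in> A \<and> p \<in> dom_chart c)"
  shows "v c = 0"
  using assms unfolding tangent_space_def by blast

lemma tangent_spaceI:
  assumes "\<And>c d. c \<in> A \<Longrightarrow> d \<in> A \<Longrightarrow> p \<in> dom_chart c \<Longrightarrow> p \<in> dom_chart d \<Longrightarrow>
      v d = frechet_derivative (coords d \<circ> chart_inv c) (at (coords c p)) (v c)"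
    and "\<And>c. \<not> (c \<in> A \<and> p \<in> dom_chart c) \<Longrightarrow> v c = 0"
  shows "v \<in> tangent_space A p"
  using assms unfolding tangent_space_def by blast

lemma tangent_space_zero:
  assumes "smooth_atlas A"
  shows "0 \<in> tangent_space A p"
proof (rule tangent_spaceI)
  fix c d assume "c \<in> A" "d \<in> A" "p \<in> dom_chart c" "p \<in> dom_chart d"
  note linear_0[OF linear_transition_derivative[OF assms this]]
  then show "0 d = frechet_derivative (coords d \<circ> chart_inv c) (at (coords c p)) (0 c)"
    by (simp add: zero_fun_def)
qed (simp add: zero_fun_def)

lemma tangent_space_add:
  assumes "smooth_atlas A" and u: "u \<in> tangent_space A p" and v: "v \<in> tangent_space A p"
  shows "u + v \<in> tangent_space A p"
proof (rule tangent_spaceI)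
  fix c d assume cd: "c \<in> A" "d \<in> A" "p \<in> dom_chart c" "p \<in> dom_chart d"
  show "(u + v) d = frechet_derivative (coords d \<circ> chart_inv c) (at (coords c p)) ((u + v) c)"
    using linear_add[OF linear_transition_derivative[OF assms(1) cd]]
      tangent_space_transform[OF u cd] tangent_space_transform[OF v cd] by simp
qed (simp add: tangent_space_outside[OF u] tangent_space_outside[OF v])

lemma tangent_space_scaleR:
  assumes "smooth_atlas A" and v: "v \<in> tangent_space A p"
  shows "r *\<^sub>R v \<in> tangent_space A p"
proof (rule tangent_spaceI)
  fix c d assume cd: "c \<in> A" "d \<in> A" "p \<in> dom_chart c" "p \<in> dom_chart d"
  show "(r *\<^sub>R v) d = frechet_derivative (coords d \<circ> chart_inv c) (at (coords c p)) ((r *\<^sub>R v) c)"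
    using linear_scale[OF linear_transition_derivative[OF assms(1) cd]]
      tangent_space_transform[OF v cd] by (simp add: scaleR_fun_def)
qed (simp add: scaleR_fun_def tangent_space_outside[OF v])

lemma tangent_space_sum:
  assumes "smooth_atlas A" "finite B" "\<And>i. i \<in> B \<Longrightarrow> v i \<in> tangent_space A p"
  shows "(\<Sum>i\<in>B. v i) \<in> tangent_space A p"
  using assms(2,3)
  by induction (auto intro: tangent_space_zero[OF assms(1)] tangent_space_add[OF assms(1)])

lemma coord_vfield_tangent:
  assumes "smooth_atlas A" "c \<in> A" "p \<in> dom_chart c"
  shows "coord_vfield A c i p \<in> tangent_space A p"
proof (rule tangent_spaceI)
  fix d e assume de: "d \<in> A" "e \<in> A" "p \<in> dom_chart d" "p \<in> dom_chart e"
  show "coord_vfield A c i p e =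
      frechet_derivative (coords e \<circ> chart_inv d) (at (coords d p)) (coord_vfield A c i p d)"
    using de by (simp add: coord_vfield_def)
      (rule transition_derivative_cocycle[OF assms de(1,3,2,4)])
qed (auto simp: coord_vfield_def)

lemma sum_fun_apply: "(\<Sum>i\<in>B. v i) x = (\<Sum>i\<in>B. v i x)"
  by (induction B rule: infinite_finite_induct) auto

text \<open>
  The components of \<open>v\<close> in any chart are the images of those in \<open>c\<close> under a linear map, and the
  components of the coordinate fields are the images of the standard basis vectors under the same
  map.
\<close>

lemma tangent_vector_expansion:
  assumes A: "smooth_atlas A" and c: "c \<in> A" "p \<in> dom_chart c"
    and v: "v \<in> tangent_space A p"
  shows "v = (\<Sum>i\<in>UNIV. (v c $ i) *\<^sub>R coord_vfield A c i p)"
proof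
  fix d
  show "v d = (\<Sum>i\<in>UNIV. (v c $ i) *\<^sub>R coord_vfield A c i p) d"
  proof (cases "d \<in> A \<and> p \<in> dom_chart d")
    case True
    let ?L = "frechet_derivative (coords d \<circ> chart_inv c) (at (coords c p))"
    have lin: "linear ?L"
      using linear_transition_derivative[OF A c(1) _ c(2)] True by blast
    have "v d = ?L (v c)"
      using tangent_space_transform[OF v c(1) _ c(2)] True by blast
    also have "v c = (\<Sum>i\<in>UNIV. (v c $ i) *\<^sub>R axis i 1)"
      using basis_expansion[of "v c"] by (simp add: scalar_mult_eq_scaleR)
    also have "?L \<dots> = (\<Sum>i\<in>UNIV. (v c $ i) *\<^sub>R ?L (axis i 1))"
      by (simp add: linear_sum[OF lin] linear_scale[OF lin])
    finally show ?thesis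
      using True by (simp add: sum_fun_apply scaleR_fun_def coord_vfield_def)
  next
    case False
    then have "v d = 0" by (rule tangent_space_outside[OF v])
    with False show ?thesis
      by (auto simp: sum_fun_apply scaleR_fun_def coord_vfield_def)
  qed
qed

text \<open>
  In a second chart \<open>d\<close>, the field is the partial derivative of the coordinate change from \<open>c\<close> to \<open>d\<close>,
  but taken at the \<open>c\<close>-coordinates of the point; as a function of its \<open>d\<close>-coordinates it is
  therefore that partial derivative composed with the inverse coordinate change.
\<close>

lemma smooth_coord_vfield:
  assumes A: "smooth_atlas A" and c: "c \<in> A"
  shows "smooth_vfield A (dom_chart c) (coord_vfield A c i)"
  unfolding smooth_vfield_def
proof (intro conjI ballI)
  show "open (dom_chart c)"
    using A c unfolding smooth_atlas_def is_chart_def by blast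
  show "coord_vfield A c i p \<in> tangent_space A p" if "p \<in> dom_chart c" for p
    using coord_vfield_tangent[OF A c that] .
  fix d assume d: "d \<in> A"
  let ?S = "coords d ` (dom_chart d \<inter> dom_chart c)"
  let ?T = "coords c ` (dom_chart c \<inter> dom_chart d)"
  let ?h = "coords c \<circ> chart_inv d"
  let ?D = "\<lambda>y. frechet_derivative (coords d \<circ> chart_inv c) (at y) (axis i 1)"
  have h: "open ?S" "\<And>k. Ck_on k ?h ?S"
    using smooth_transition[OF A d c] by (auto simp: smooth_on_def)
  have D: "Ck_on k ?D ?T" for k
  proof -
    have "Ck_on (Suc k) (coords d \<circ> chart_inv c) ?T"
      using smooth_transition[OF A c d] unfolding smooth_on_def by blast
    then show ?thesis by simp
  qed
  have "?h ` ?S \<subseteq> ?T"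
    using chart_inv_coords[OF A d] by auto
  then have comp: "Ck_on k (\<lambda>x. ?D (?h x)) ?S" for k
    by (rule Ck_on_compose[OF h(1) D h(2)])
  have "?D (?h x) = coord_vfield A c i (chart_inv d x) d" if "x \<in> ?S" for x
    using that d chart_inv_coords[OF A d] by (auto simp: coord_vfield_def)
  from Ck_on_cong[OF h(1) this comp]
  show "smooth_on (\<lambda>x. coord_vfield A c i (chart_inv d x) d) ?S"
    using h(1) by (simp add: smooth_on_def)
qed


section \<open>Differentiation along a curve\<close>

lemma open_curve_in_chart:
  assumes "smooth_curve A I \<alpha>" "c \<in> A"
  shows "open {s \<in> I. \<alpha> s \<in> dom_chart c}"
  using assms by (simp add: smooth_curve_def smooth_on_def)

lemma coords_has_velocity:
  assumes "smooth_curve A I \<alpha>" "c \<in> A" "t \<in> I" "\<alpha> t \<in> dom_chart c"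
  shows "((coords c \<circ> \<alpha>) has_vector_derivative velocity A \<alpha> t c) (at t)"
proof -
  have "smooth_on (coords c \<circ> \<alpha>) {s \<in> I. \<alpha> s \<in> dom_chart c}"
    using assms(1,2) unfolding smooth_curve_def by blast
  then have "(coords c \<circ> \<alpha>) differentiable (at t)"
    by (rule smooth_on_imp_differentiable) (use assms in blast)
  then show ?thesis
    using assms(2,4) by (simp add: velocity_def flip: vector_derivative_works)
qed

lemma velocity_tangent:
  assumes A: "smooth_atlas A" and \<alpha>: "smooth_curve A I \<alpha>" "t \<in> I"
  shows "velocity A \<alpha> t \<in> tangent_space A (\<alpha> t)"
proof (rule tangent_spaceI)
  fix c d
  assume "c \<in> A" "d \<in> A" "\<alpha> t \<in> dom_chart c" "\<alpha> t \<in> dom_chart d"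
  then have c: "c \<in> A" "\<alpha> t \<in> dom_chart c" and d: "d \<in> A" "\<alpha> t \<in> dom_chart d"
    by simp_all
  let ?T = "coords d \<circ> chart_inv c"
  have "(?T has_derivative frechet_derivative ?T (at (coords c (\<alpha> t)))) (at ((coords c \<circ> \<alpha>) t))"
    using transition_differentiable[OF A c(1) d(1) c(2) d(2)]
    by (simp add: frechet_derivative_works)
  from vector_derivative_diff_chain_within[OF coords_has_velocity[OF \<alpha>(1) c(1) \<alpha>(2) c(2)]
      has_derivative_at_withinI[OF this]]
  have "((?T \<circ> (coords c \<circ> \<alpha>)) has_vector_derivative
      frechet_derivative ?T (at (coords c (\<alpha> t))) (velocity A \<alpha> t c)) (at t)" .
  then have "((coords d \<circ> \<alpha>) has_vector_derivative
      frechet_derivative ?T (at (coords c (\<alpha> t))) (velocity A \<alpha> t c)) (at t)"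
  proof (rule has_vector_derivative_transform_within_open[OF _ open_curve_in_chart[OF \<alpha>(1) c(1)]])
    show "t \<in> {s \<in> I. \<alpha> s \<in> dom_chart c}" using \<alpha>(2) c(2) by simp
    show "(?T \<circ> (coords c \<circ> \<alpha>)) s = (coords d \<circ> \<alpha>) s" if "s \<in> {s \<in> I. \<alpha> s \<in> dom_chart c}" for s
      using that by (simp add: chart_inv_coords[OF A c(1)])
  qed
  then show "velocity A \<alpha> t d = frechet_derivative ?T (at (coords c (\<alpha> t))) (velocity A \<alpha> t c)"
    using coords_has_velocity[OF \<alpha>(1) d(1) \<alpha>(2) d(2)] vector_derivative_unique_at by blast
qed (auto simp: velocity_def)

text \<open>
  The chain rule for a function on the manifold restricted to a curve. The chart in the hypothesis
  is the one in which \<open>tderiv\<close> is computed.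
\<close>

lemma derivative_along_curve:
  assumes A: "smooth_atlas A" and \<alpha>: "smooth_curve A I \<alpha>" "t \<in> I"
    and diff: "(h \<circ> chart_inv (chart_at A (\<alpha> t))) differentiable
      (at (coords (chart_at A (\<alpha> t)) (\<alpha> t)))"
  shows "((\<lambda>s. h (\<alpha> s)) has_real_derivative tderiv A (\<alpha> t) (velocity A \<alpha> t) h) (at t)"
proof -
  define c where "c = chart_at A (\<alpha> t)"
  have c: "c \<in> A" "\<alpha> t \<in> dom_chart c"
    using chart_at_mem[OF A] by (simp_all add: c_def)
  let ?h = "h \<circ> chart_inv c"
  have "(?h has_derivative frechet_derivative ?h (at (coords c (\<alpha> t)))) (at ((coords c \<circ> \<alpha>) t))"
    using diff by (simp add: frechet_derivative_works c_def)
  from vector_derivative_diff_chain_within[OF coords_has_velocity[OF \<alpha>(1) c(1) \<alpha>(2) c(2)]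
      has_derivative_at_withinI[OF this]]
  have "((?h \<circ> (coords c \<circ> \<alpha>)) has_real_derivative tderiv A (\<alpha> t) (velocity A \<alpha> t) h) (at t)"
    unfolding tderiv_def Let_def c_def has_real_derivative_iff_has_vector_derivative .
  then show ?thesis
  proof (rule has_field_derivative_transform_within_open[OF _ open_curve_in_chart[OF \<alpha>(1) c(1)]])
    show "t \<in> {s \<in> I. \<alpha> s \<in> dom_chart c}" using \<alpha>(2) c(2) by simp
    show "(?h \<circ> (coords c \<circ> \<alpha>)) s = h (\<alpha> s)" if "s \<in> {s \<in> I. \<alpha> s \<in> dom_chart c}" for s
      using that by (simp add: chart_inv_coords[OF A c(1)])
  qed
qed


section \<open>The product rule for the metric along a curve\<close>

lemma metric_sym:
  assumes "lorentzian_metric A g" "u \<in> tangent_space A p" "v \<in> tangent_space A p"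
  shows "g p u v = g p v u"
  using assms(1)[unfolded lorentzian_metric_def, THEN conjunct1] assms(2,3) by blast

lemma metric_add_right:
  assumes A: "smooth_atlas A" and g: "lorentzian_metric A g"
    and u: "u \<in> tangent_space A p" and v: "v \<in> tangent_space A p" and w: "w \<in> tangent_space A p"
  shows "g p u (v + w) = g p u v + g p u w"
proof -
  have "g p (v + w) u = g p v u + g p w u"
    using g[unfolded lorentzian_metric_def, THEN conjunct2, THEN conjunct1] u v w by blast
  then show ?thesis
    by (simp only: metric_sym[OF g u] tangent_space_add[OF A] v w)
qed

lemma metric_scaleR_right:
  assumes A: "smooth_atlas A" and g: "lorentzian_metric A g"
    and u: "u \<in> tangent_space A p" and v: "v \<in> tangent_space A p"
  shows "g p u (r *\<^sub>R v) = r * g p u v"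
proof -
  have "g p (r *\<^sub>R v) u = r * g p v u"
    using g[unfolded lorentzian_metric_def, THEN conjunct2, THEN conjunct2, THEN conjunct1] u v
    by blast
  then show ?thesis
    by (simp only: metric_sym[OF g u] tangent_space_scaleR[OF A] v)
qed

lemma metric_sum_right:
  assumes "smooth_atlas A" "lorentzian_metric A g"
    and "u \<in> tangent_space A p" "finite B" "\<And>i. i \<in> B \<Longrightarrow> v i \<in> tangent_space A p"
  shows "g p u (\<Sum>i\<in>B. v i) = (\<Sum>i\<in>B. g p u (v i))"
  using assms(4,5)
proof (induction B rule: finite_induct)
  case empty
  show ?case
    using metric_scaleR_right[OF assms(1-3) tangent_space_zero[OF assms(1)], of 0]
    by (simp del: zero_fun_apply)
next
  case (insert i B)
  have "g p u (\<Sum>i\<in>insert i B. v i) = g p u (v i + (\<Sum>i\<in>B. v i))"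
    by (simp only: sum.insert[OF insert.hyps])
  also have "\<dots> = g p u (v i) + g p u (\<Sum>i\<in>B. v i)"
    using insert by (intro metric_add_right[OF assms(1-3)] tangent_space_sum[OF assms(1)]) auto
  also have "\<dots> = (\<Sum>i\<in>insert i B. g p u (v i))"
    using insert by simp
  finally show ?case .
qed

text \<open>
  The smoothness of a metric is a statement about pairs of coordinate fields. It passes to
  \<open>g(G, \<partial>\<^sub>i)\<close> through the expansion \<open>g(G, \<partial>\<^sub>i) = \<Sum>\<^sub>j G\<^sup>j g(\<partial>\<^sub>j, \<partial>\<^sub>i)\<close>.
\<close>

lemma metric_coord_vfield_differentiable:
  assumes A: "smooth_atlas A" and g: "lorentzian_metric A g"
    and G: "smooth_vfield A U G" and c: "c \<in> A" and p: "p \<in> U" "p \<in> dom_chart c"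
  shows "((\<lambda>q. g q (G q) (coord_vfield A c i q)) \<circ> chart_inv c) differentiable (at (coords c p))"
proof -
  let ?S = "coords c ` (dom_chart c \<inter> U)"
  let ?X = "coord_vfield A c"
  have S: "coords c p \<in> ?S" "open ?S" and
    dG: "(\<lambda>x. G (chart_inv c x) c) differentiable (at (coords c p))"
    using G c p smooth_on_imp_differentiable[of "\<lambda>x. G (chart_inv c x) c" ?S]
    by (auto simp: smooth_vfield_def smooth_on_def)
  have dg: "(\<lambda>x. g (chart_inv c x) (?X j (chart_inv c x)) (?X i (chart_inv c x)))
      differentiable (at (coords c p))" for j
  proof -
    have "smooth_fun A (dom_chart c) (\<lambda>q. g q (?X j q) (?X i q))"
      using g c unfolding lorentzian_metric_def by simp
    then have "smooth_on ((\<lambda>q. g q (?X j q) (?X i q)) \<circ> chart_inv c)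
        (coords c ` (dom_chart c \<inter> dom_chart c))"
      using c unfolding smooth_fun_def by blast
    from smooth_on_imp_differentiable[OF this, of "coords c p"] p
    show ?thesis by (simp add: o_def)
  qed
  let ?F = "\<lambda>x. \<Sum>j\<in>UNIV. (G (chart_inv c x) c $ j) *
      g (chart_inv c x) (?X j (chart_inv c x)) (?X i (chart_inv c x))"
  have "(\<lambda>x. G (chart_inv c x) c $ j) differentiable (at (coords c p))" for j
    using dG bounded_linear.has_derivative[OF bounded_linear_vec_nth]
    unfolding differentiable_def by blast
  then have dF: "?F differentiable (at (coords c p))"
    by (intro differentiable_sum differentiable_mult dg ballI) auto
  have "?F x = ((\<lambda>q. g q (G q) (?X i q)) \<circ> chart_inv c) x" if "x \<in> ?S" for x
  proof -
    from that obtain q where q: "x = coords c q" "q \<in> dom_chart c" "q \<in> U" by blast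
    note X_tan = coord_vfield_tangent[OF A c q(2)]
    have Gq: "G q \<in> tangent_space A q"
      using G q(3) by (auto simp: smooth_vfield_def)
    have "g q (G q) (?X i q) = g q (?X i q) (G q)"
      by (rule metric_sym[OF g Gq X_tan])
    also have "\<dots> = g q (?X i q) (\<Sum>j\<in>UNIV. (G q c $ j) *\<^sub>R ?X j q)"
      using tangent_vector_expansion[OF A c q(2) Gq] by simp
    also have "\<dots> = (\<Sum>j\<in>UNIV. (G q c $ j) * g q (?X i q) (?X j q))"
      by (simp add: metric_sum_right[OF A g] metric_scaleR_right[OF A g] X_tan
          tangent_space_scaleR[OF A])
    also have "\<dots> = (\<Sum>j\<in>UNIV. (G q c $ j) * g q (?X j q) (?X i q))"
      by (simp only: metric_sym[OF g X_tan X_tan])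
    finally show ?thesis
      by (simp add: q(1) chart_inv_coords[OF A c q(2)])
  qed
  then show ?thesis
    using dF S has_derivative_transform_within_open[of ?F _ "coords c p" UNIV ?S]
    unfolding differentiable_def by blast
qed

lemma connection_tangent:
  assumes "affine_connection A nabla" "smooth_vfield A U Y" "p \<in> U" "v \<in> tangent_space A p"
  shows "nabla p v Y \<in> tangent_space A p"
  using assms(1)[unfolded affine_connection_def, THEN conjunct2, THEN conjunct1, rule_format,
      OF assms(2-4)] .

text \<open>
  Near \<open>t\<close> one has \<open>V = \<Sum>\<^sub>i V\<^sup>i \<partial>\<^sub>i\<close> in a chart around \<open>\<alpha> t\<close>, and so \<open>g(G, V) = \<Sum>\<^sub>i V\<^sup>i g(G, \<partial>\<^sub>i)\<close>. The
  functions \<open>g(G, \<partial>\<^sub>i)\<close> come from the manifold; along the curve they have the derivative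
  \<open>g(\<nabla>\<^bsub>\<alpha>'\<^esub> G, \<partial>\<^sub>i) + g(G, \<nabla>\<^bsub>\<alpha>'\<^esub> \<partial>\<^sub>i)\<close> by metric compatibility. Summing up, the first terms give
  \<open>g(\<nabla>\<^bsub>\<alpha>'\<^esub> G, V)\<close>, and the second ones together with those in \<open>(V\<^sup>i)'\<close> are the covariant derivative of \<open>V\<close>
  paired with \<open>G\<close>.
\<close>

lemma metric_derivative_along_curve:
  assumes M: "lorentzian_manifold A g" and nabla: "levi_civita A g nabla"
    and \<alpha>: "smooth_curve A I \<alpha>" "t \<in> I"
    and G: "smooth_vfield A UNIV G" and V: "smooth_vfield_along A I \<alpha> V"
  shows "((\<lambda>s. g (\<alpha> s) (G (\<alpha> s)) (V s)) has_real_derivative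
    g (\<alpha> t) (nabla (\<alpha> t) (velocity A \<alpha> t) G) (V t) +
    g (\<alpha> t) (G (\<alpha> t)) (cov_deriv_along A nabla \<alpha> V t)) (at t)"
proof -
  have A: "smooth_atlas A" and g: "lorentzian_metric A g"
    using M by (auto simp: lorentzian_manifold_def)
  define c where "c = chart_at A (\<alpha> t)"
  have c: "c \<in> A" "\<alpha> t \<in> dom_chart c"
    using chart_at_mem[OF A] by (simp_all add: c_def)
  let ?p = "\<alpha> t" and ?v = "velocity A \<alpha> t" and ?X = "coord_vfield A c"
  let ?a = "\<lambda>i. vector_derivative (\<lambda>s. V s c $ i) (at t)"
  have conn: "affine_connection A nabla" and comp: "metric_compatible A g nabla"
    using nabla by (auto simp: levi_civita_def)
  have v: "?v \<in> tangent_space A ?p" by (rule velocity_tangent[OF A \<alpha>])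
  have G_tan: "G q \<in> tangent_space A q" for q
    using G by (simp add: smooth_vfield_def)
  have V_tan: "V s \<in> tangent_space A (\<alpha> s)" if "s \<in> I" for s
    using V that by (simp add: smooth_vfield_along_def)
  note X_tan = coord_vfield_tangent[OF A c(1)]
  note X_smooth = smooth_coord_vfield[OF A c(1)]
  \<comment> \<open>Metric compatibility wants both fields on the same open set, here the domain of the chart.\<close>
  have G_smooth: "smooth_vfield A (dom_chart c) G"
  proof -
    have "open (dom_chart c)" using X_smooth by (simp add: smooth_vfield_def)
    moreover have "smooth_on (\<lambda>x. G (chart_inv d x) d) (coords d ` (dom_chart d \<inter> dom_chart c))"
      if "d \<in> A" for d
    proof -
      have "smooth_on (\<lambda>x. G (chart_inv d x) d) (coords d ` dom_chart d)"
        using G that by (simp add: smooth_vfield_def)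
      moreover have "open (coords d ` (dom_chart d \<inter> dom_chart c))"
        using smooth_transition[OF A that c(1)] by (simp add: smooth_on_def)
      ultimately show ?thesis
        unfolding smooth_on_def by (auto intro: Ck_on_subset)
    qed
    ultimately show ?thesis by (simp add: smooth_vfield_def G_tan)
  qed
  have nablaX_tan: "nabla ?p ?v (?X i) \<in> tangent_space A ?p" for i
    by (rule connection_tangent[OF conn X_smooth c(2) v])
  have nablaG_tan: "nabla ?p ?v G \<in> tangent_space A ?p"
    by (rule connection_tangent[OF conn G UNIV_I v])

  have dV: "((\<lambda>s. V s c $ i) has_real_derivative ?a i) (at t)" for i
  proof -
    have "smooth_on (\<lambda>s. V s c) {s \<in> I. \<alpha> s \<in> dom_chart c}"
      using V c(1) by (simp add: smooth_vfield_along_def)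
    then have "(\<lambda>s. V s c) differentiable (at t)"
      by (rule smooth_on_imp_differentiable) (use \<alpha> c in blast)
    then have "(\<lambda>s. V s c $ i) differentiable (at t)"
      using bounded_linear.has_derivative[OF bounded_linear_vec_nth]
      unfolding differentiable_def by blast
    then show ?thesis
      by (simp add: has_real_derivative_iff_has_vector_derivative flip: vector_derivative_works)
  qed
  have dg: "((\<lambda>s. g (\<alpha> s) (G (\<alpha> s)) (?X i (\<alpha> s))) has_real_derivative
      g ?p (nabla ?p ?v G) (?X i ?p) + g ?p (G ?p) (nabla ?p ?v (?X i))) (at t)" for i
  proof -
    have "((\<lambda>s. g (\<alpha> s) (G (\<alpha> s)) (?X i (\<alpha> s))) has_real_derivative
        tderiv A ?p ?v (\<lambda>q. g q (G q) (?X i q))) (at t)"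
      using metric_coord_vfield_differentiable[OF A g G c(1) UNIV_I c(2)]
      by (intro derivative_along_curve[OF A \<alpha>]) (simp add: c_def)
    also have "tderiv A ?p ?v (\<lambda>q. g q (G q) (?X i q)) =
        g ?p (nabla ?p ?v G) (?X i ?p) + g ?p (G ?p) (nabla ?p ?v (?X i))"
      by (rule comp[unfolded metric_compatible_def, rule_format, OF G_smooth X_smooth c(2) v])
    finally show ?thesis .
  qed

  let ?D = "\<Sum>i\<in>UNIV. ?a i * g ?p (G ?p) (?X i ?p) +
      (g ?p (nabla ?p ?v G) (?X i ?p) + g ?p (G ?p) (nabla ?p ?v (?X i))) * (V t c $ i)"
  have "((\<lambda>s. \<Sum>i\<in>UNIV. (V s c $ i) * g (\<alpha> s) (G (\<alpha> s)) (?X i (\<alpha> s)))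
      has_real_derivative ?D) (at t)"
    by (intro DERIV_sum DERIV_mult dV dg)
  moreover have "(\<Sum>i\<in>UNIV. (V s c $ i) * g (\<alpha> s) (G (\<alpha> s)) (?X i (\<alpha> s))) =
      g (\<alpha> s) (G (\<alpha> s)) (V s)" if s: "s \<in> {s \<in> I. \<alpha> s \<in> dom_chart c}" for s
  proof -
    have "g (\<alpha> s) (G (\<alpha> s)) (V s) =
        g (\<alpha> s) (G (\<alpha> s)) (\<Sum>i\<in>UNIV. (V s c $ i) *\<^sub>R ?X i (\<alpha> s))"
      using tangent_vector_expansion[OF A c(1) _ V_tan] s by simp
    also have "\<dots> = (\<Sum>i\<in>UNIV. (V s c $ i) * g (\<alpha> s) (G (\<alpha> s)) (?X i (\<alpha> s)))"
      using s by (simp add: metric_sum_right[OF A g] metric_scaleR_right[OF A g] X_tan G_tan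
          tangent_space_scaleR[OF A])
    finally show ?thesis by simp
  qed
  ultimately have "((\<lambda>s. g (\<alpha> s) (G (\<alpha> s)) (V s)) has_real_derivative ?D) (at t)"
    using has_field_derivative_transform_within_open[OF _ open_curve_in_chart[OF \<alpha>(1) c(1)]] \<alpha>(2) c(2)
    by (smt (verit) mem_Collect_eq)
  moreover have "?D = g ?p (nabla ?p ?v G) (V t) + g ?p (G ?p) (cov_deriv_along A nabla \<alpha> V t)"
  proof -
    have "g ?p (nabla ?p ?v G) (V t) =
        g ?p (nabla ?p ?v G) (\<Sum>i\<in>UNIV. (V t c $ i) *\<^sub>R ?X i ?p)"
      using tangent_vector_expansion[OF A c V_tan[OF \<alpha>(2)]] by simp
    also have "\<dots> = (\<Sum>i\<in>UNIV. (V t c $ i) * g ?p (nabla ?p ?v G) (?X i ?p))"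
      by (simp add: metric_sum_right[OF A g] metric_scaleR_right[OF A g] X_tan[OF c(2)]
          nablaG_tan tangent_space_scaleR[OF A])
    finally have 1: "g ?p (nabla ?p ?v G) (V t) = \<dots>" .
    have "cov_deriv_along A nabla \<alpha> V t =
        (\<Sum>i\<in>UNIV. ?a i *\<^sub>R ?X i ?p + (V t c $ i) *\<^sub>R nabla ?p ?v (?X i))"
      by (simp add: cov_deriv_along_def Let_def c_def)
    then have "g ?p (G ?p) (cov_deriv_along A nabla \<alpha> V t) =
        (\<Sum>i\<in>UNIV. ?a i * g ?p (G ?p) (?X i ?p) + (V t c $ i) * g ?p (G ?p) (nabla ?p ?v (?X i)))"
      by (simp add: metric_sum_right[OF A g] metric_add_right[OF A g] metric_scaleR_right[OF A g]
          X_tan[OF c(2)] nablaX_tan G_tan tangent_space_scaleR[OF A] tangent_space_add[OF A])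
    with 1 show ?thesis
      by (simp add: sum.distrib algebra_simps)
  qed
  ultimately show ?thesis by simp
qed

text \<open>
  The form in which the Hessian enters: since \<open>G\<close> is parallel, differentiating a constant \<open>g(G, V)\<close>
  leaves only the term with the covariant derivative of \<open>V\<close>.
\<close>

lemma constant_metric_cov_deriv_zero:
  assumes M: "lorentzian_manifold A g" and nabla: "levi_civita A g nabla"
    and I: "open I" and \<alpha>: "smooth_curve A I \<alpha>"
    and G: "smooth_vfield A UNIV G"
    and H: "\<forall>p. \<forall>u\<in>tangent_space A p. \<forall>v\<in>tangent_space A p. hessian g nabla G p u v = 0"
    and V: "smooth_vfield_along A I \<alpha> V"
    and const: "\<forall>s\<in>I. g (\<alpha> s) (G (\<alpha> s)) (V s) = k" and t: "t \<in> I"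
  shows "g (\<alpha> t) (G (\<alpha> t)) (cov_deriv_along A nabla \<alpha> V t) = 0"
proof -
  have "smooth_atlas A" using M by (simp add: lorentzian_manifold_def)
  then have "velocity A \<alpha> t \<in> tangent_space A (\<alpha> t)"
    using \<alpha> t by (rule velocity_tangent)
  moreover have "V t \<in> tangent_space A (\<alpha> t)"
    using V t by (simp add: smooth_vfield_along_def)
  ultimately have "g (\<alpha> t) (nabla (\<alpha> t) (velocity A \<alpha> t) G) (V t) = 0"
    using H by (simp add: hessian_def)
  with metric_derivative_along_curve[OF M nabla \<alpha> t G V]
  have "((\<lambda>s. g (\<alpha> s) (G (\<alpha> s)) (V s)) has_real_derivative
      g (\<alpha> t) (G (\<alpha> t)) (cov_deriv_along A nabla \<alpha> V t)) (at t)" by simp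
  moreover have "((\<lambda>s. g (\<alpha> s) (G (\<alpha> s)) (V s)) has_real_derivative 0) (at t)"
    by (rule has_field_derivative_transform_within_open[OF DERIV_const[of k] I t])
      (simp add: const)
  ultimately show ?thesis by (rule DERIV_unique)
qed


section \<open>Helices and slant helices\<close>

theorem corollary2:
  fixes A :: "('m::{t2_space,second_countable_topology}, 4) atlas"
    and g :: "('m, 4) metric"
    and nabla :: "('m, 4) connection"
    and I :: "real set"
    and \<alpha> :: "real \<Rightarrow> 'm"
    and \<xi> N W\<^sub>1 W\<^sub>2 :: "real \<Rightarrow> ('m, 4) tvec"
    and \<sigma>\<^sub>1 \<sigma>\<^sub>2 :: "real \<Rightarrow> real"
    and f :: "'m \<Rightarrow> real"
    and gradf :: "'m \<Rightarrow> ('m, 4) tvec"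
  assumes "lorentzian_manifold A g"
    and "levi_civita A g nabla"
    and "open I" and "is_interval I" and "I \<noteq> {}"
    and "null_cartan_curve A g nabla I \<alpha>"
    and "pseudo_arc A g nabla I \<alpha>"
    and "frenet_frame A g nabla I \<alpha> \<xi> N W\<^sub>1 W\<^sub>2 \<sigma>\<^sub>1 \<sigma>\<^sub>2"
    and "\<forall>t\<in>I. \<sigma>\<^sub>1 t \<noteq> 0" and "\<forall>t\<in>I. \<sigma>\<^sub>2 t \<noteq> 0"
    and "smooth_fun A UNIV f"
    and "is_gradient A g f gradf"
    and "eikonal_along g gradf I \<alpha>"
    and "\<forall>p. \<forall>u\<in>tangent_space A p. \<forall>v\<in>tangent_space A p. hessian g nabla gradf p u v = 0"
    and "null_eikonal_helix g gradf I \<alpha> \<xi>"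
  shows "\<not> null_eikonal_slant_helix g gradf I \<alpha> N"
proof
  assume slant: "null_eikonal_slant_helix g gradf I \<alpha> N"
  have A: "smooth_atlas A" and g: "lorentzian_metric A g"
    using assms(1) by (auto simp: lorentzian_manifold_def)
  have \<alpha>: "smooth_curve A I \<alpha>"
    using assms(6) by (simp add: null_cartan_curve_def null_curve_def)
  have G: "smooth_vfield A UNIV gradf"
    using assms(12) by (simp add: is_gradient_def)
  note frame = assms(8)[unfolded frenet_frame_def]
  have smooth: "smooth_vfield_along A I \<alpha> \<xi>" "smooth_vfield_along A I \<alpha> N"
    "smooth_vfield_along A I \<alpha> W\<^sub>1" "smooth_vfield_along A I \<alpha> W\<^sub>2"
    using frame by auto
  have tan: "V t \<in> tangent_space A (\<alpha> t)" if "smooth_vfield_along A I \<alpha> V" "t \<in> I" for V t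
    using that by (simp add: smooth_vfield_along_def)
  have G_tan: "gradf q \<in> tangent_space A q" for q
    using G by (simp add: smooth_vfield_def)
  note step = constant_metric_cov_deriv_zero[OF assms(1-3) \<alpha> G assms(14)]
  note g_lin = metric_add_right[OF A g G_tan] metric_scaleR_right[OF A g G_tan]
    tan tangent_space_scaleR[OF A]
  let ?gG = "\<lambda>V t. g (\<alpha> t) (gradf (\<alpha> t)) (V t)"
  obtain k where k: "k \<noteq> 0" "\<forall>t\<in>I. ?gG \<xi> t = k"
    using assms(15) by (auto simp: null_eikonal_helix_def)
  obtain l where l: "\<forall>t\<in>I. ?gG N t = l"
    using slant by (auto simp: null_eikonal_slant_helix_def)
  \<comment> \<open>Each of the next steps differentiates one constant product, using the Frenet equations for
    \<open>\<xi>\<close>, \<open>N\<close> and \<open>W\<^sub>2\<close> in turn.\<close>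
  have W1: "\<forall>t\<in>I. ?gG W\<^sub>1 t = 0"
    using step[OF smooth(1) k(2)] frame by simp
  have W2: "\<forall>t\<in>I. ?gG W\<^sub>2 t = 0"
  proof
    fix t assume t: "t \<in> I"
    have "0 = g (\<alpha> t) (gradf (\<alpha> t)) (\<sigma>\<^sub>1 t *\<^sub>R W\<^sub>1 t + \<sigma>\<^sub>2 t *\<^sub>R W\<^sub>2 t)"
      using step[OF smooth(2) l t] frame t by simp
    also have "\<dots> = \<sigma>\<^sub>1 t * ?gG W\<^sub>1 t + \<sigma>\<^sub>2 t * ?gG W\<^sub>2 t"
      using t smooth by (simp add: g_lin)
    finally show "?gG W\<^sub>2 t = 0" using W1 t assms(10) by simp
  qed
  obtain t where t: "t \<in> I" using assms(5) by blast
  have "0 = g (\<alpha> t) (gradf (\<alpha> t)) ((- \<sigma>\<^sub>2 t) *\<^sub>R \<xi> t)"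
    using step[OF smooth(4) W2 t] frame t by simp
  also have "\<dots> = - \<sigma>\<^sub>2 t * ?gG \<xi> t"
    using t smooth by (simp only: g_lin)
  finally show False using k t assms(10) by simp
qed

end
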